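(* Let $V$ be a reflexive Banach space and a vector lattice with $V_+$ closed. Let $V\hookrightarrow H$ be a continuous embedding into a reflexive Banach space $H$, let $U$ be a reflexive Banach space compactly embedded in $V^*$, and let $U_{ad}\subseteq U$ be non-empty and weakly sequentially closed. Let $\nu>0$ and $y_d\in H$. Suppose that $\mathbf Q(u)$ is non-empty for every $u\in U_{ad}$; that either there exists $v_0\in V$ such that $v_0\le\Phi(v)$ for all $v\in V$, or there is a constant $C_X<C_a/C_b$ with $\|\Phi(v)\|_V\le C_X\|v\|_V$ for all $v\in V$; and that $\Phi\colon V\to V$ is completely continuous. Then there exist an optimal control $u^*\in U_{ad}$ and an associated state $y^*\in\mathbf Q(u^* )$ for the problem $$\min_{\substack{u\in U_{ad}\\ y\in\mathbf Q(u)}}\ \frac12\|y-y_d\|_H^2+\frac\nu2\|u\|_U^2 .$$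
   Context: All spaces are real; $\langle\cdot,\cdot\rangle$ is the pairing of $V^*$ and $V$. $V$ is a vector lattice for a partial order $\le$ ($u\le v$ implies $u+w\le v+w$ and $\lambda u\le\lambda v$ for $w\in V,\lambda\ge0$; $\inf(u,v),\sup(u,v)$ exist in $V$); $V_+:=\{v\in V:v\ge0\}$. With $u^+:=\sup(0,u)$, $u^-:=u^+-u$, $A\colon V\to V^*$ is linear and $C_a,C_b>0$ are constants with $\langle Au,v\rangle\le C_b\|u\|_V\|v\|_V$, $\langle Au,u\rangle\ge C_a\|u\|_V^2$, $\langle Au^+,u^-\rangle\le0$ for all $u,v\in V$. $\Phi\colon V\to V$ is a given map; it is completely continuous if $v_n\rightharpoonup v$ in $V$ implies $\Phi(v_n)\to\Phi(v)$ in $V$. For $g\in V^*$, $\mathbf Q(g)$ is the set of all $y\in V$ with $y\le\Phi(y)$ and $\langle Ay-g,y-v\rangle\le0$ for all $v\in V$ with $v\le\Phi(y)$. Weakly sequentially closed: $u_n\in U_{ad}$ and $u_n\rightharpoonup u$ in $U$ imply $u\in U_{ad}$. *)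

theory Defs
  imports "HOL-Analysis.Analysis"
begin

text \<open>
  The dual of a real normed space \<open>'a\<close> is \<open>'a \<Rightarrow>\<^sub>L real\<close>, and the pairing of \<open>f\<close> and \<open>v\<close> is
  \<open>blinfun_apply f v\<close>. A Banach space that is also a vector lattice is a type of sort
  \<open>{banach, ordered_real_vector, lattice}\<close>; this sort postulates no compatibility
  between the norm and the order.
\<close>

text \<open>Surjectivity of the canonical map into the bidual.\<close>

definition reflexive_space :: "'a::real_normed_vector itself \<Rightarrow> bool"
  where "reflexive_space _ \<longleftrightarrow>
    (\<forall>F :: ('a \<Rightarrow>\<^sub>L real) \<Rightarrow>\<^sub>L real. \<exists>x::'a. \<forall>f. blinfun_apply F f = blinfun_apply f x)"

definition weakly_convergent_to :: "(nat \<Rightarrow> 'a::real_normed_vector) \<Rightarrow> 'a \<Rightarrow> bool"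
    (infix \<open>\<rightharpoonup>\<close> 60)
  where "X \<rightharpoonup> x \<longleftrightarrow> (\<forall>f :: 'a \<Rightarrow>\<^sub>L real. (\<lambda>n. blinfun_apply f (X n)) \<longlonglongrightarrow> blinfun_apply f x)"

definition weakly_seq_closed :: "'a::real_normed_vector set \<Rightarrow> bool"
  where "weakly_seq_closed S \<longleftrightarrow> (\<forall>X x. (\<forall>n. X n \<in> S) \<longrightarrow> X \<rightharpoonup> x \<longrightarrow> x \<in> S)"

definition completely_continuous ::
    "('a::real_normed_vector \<Rightarrow> 'b::real_normed_vector) \<Rightarrow> bool"
  where "completely_continuous \<Phi> \<longleftrightarrow> (\<forall>X x. X \<rightharpoonup> x \<longrightarrow> (\<lambda>n. \<Phi> (X n)) \<longlonglongrightarrow> \<Phi> x)"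

definition continuous_embedding ::
    "('a::real_normed_vector \<Rightarrow> 'b::real_normed_vector) \<Rightarrow> bool"
  where "continuous_embedding i \<longleftrightarrow> bounded_linear i \<and> inj i"

definition compact_embedding ::
    "('a::real_normed_vector \<Rightarrow> 'b::real_normed_vector) \<Rightarrow> bool"
  where "compact_embedding j \<longleftrightarrow>
    continuous_embedding j \<and> (\<forall>S. bounded S \<longrightarrow> compact (closure (j ` S)))"

definition pos_part :: "'a::{ordered_real_vector, lattice} \<Rightarrow> 'a"
  where "pos_part u = sup 0 u"

definition neg_part :: "'a::{ordered_real_vector, lattice} \<Rightarrow> 'a"
  where "neg_part u = pos_part u - u"

definition QVI_solutions ::
    "('v \<Rightarrow> ('v \<Rightarrow>\<^sub>L real)) \<Rightarrow> ('v \<Rightarrow> 'v) \<Rightarrow> ('v \<Rightarrow>\<^sub>L real)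
      \<Rightarrow> ('v::{banach, ordered_real_vector, lattice}) set"
  where "QVI_solutions A \<Phi> g =
    {y. y \<le> \<Phi> y \<and> (\<forall>v. v \<le> \<Phi> y \<longrightarrow> blinfun_apply (A y - g) (y - v) \<le> 0)}"

text \<open>\<open>i\<close> is the embedding of the state space into the observation space.\<close>

definition cost ::
    "('v \<Rightarrow> 'h::real_normed_vector) \<Rightarrow> 'h \<Rightarrow> real \<Rightarrow> 'u::real_normed_vector \<Rightarrow> 'v \<Rightarrow> real"
  where "cost i y\<^sub>d \<nu> u y = 1 / 2 * (norm (i y - y\<^sub>d))\<^sup>2 + \<nu> / 2 * (norm u)\<^sup>2"

end

theory Submission
  imports Defs "HOL-Complex_Analysis.Great_Picard"
begin

text \<open>
  Direct method. Along a minimizing sequence the controls are bounded because \<open>\<nu> > 0\<close>, and the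
  states are bounded by coercivity, testing the inequality with \<open>v\<^sub>0\<close> or with \<open>\<Phi> y\<close>. By
  reflexivity a subsequence converges weakly; compactness of \<open>j\<close> and complete continuity of \<open>\<Phi>\<close>
  make the data and the obstacles converge strongly, which suffices to pass to the limit in the
  variational inequality, and the cost is weakly lower semicontinuous.

  Weak sequential compactness is derived from the Hahn--Banach theorem for sublinear functionals,
  whose linear minorants are the minimal sublinear functionals given by Zorn's lemma.
\<close>

section \<open>The Hahn--Banach theorem\<close>

text \<open>Homogeneity is required for \<open>t > 0\<close> only, so the infimum constructions
  below have no case \<open>t = 0\<close>; the value at 0 follows from \<open>t = 2\<close>.\<close>

definition sublinear :: "('a::real_vector \<Rightarrow> real) \<Rightarrow> bool"
  where "sublinear p \<longleftrightarrow>
    (\<forall>x y. p (x + y) \<le> p x + p y) \<and> (\<forall>t>0. \<forall>x. p (t *\<^sub>R x) = t * p x)"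

lemma sublinear_add: "sublinear p \<Longrightarrow> p (x + y) \<le> p x + p y"
  and sublinear_scaleR: "sublinear p \<Longrightarrow> t > 0 \<Longrightarrow> p (t *\<^sub>R x) = t * p x"
  by (auto simp: sublinear_def)

text \<open>The inequality for \<open>inverse t\<close> at the point \<open>t *\<^sub>R x\<close> is
  the converse of the inequality for \<open>t\<close> at \<open>x\<close>.\<close>

lemma sublinearI:
  assumes "\<And>x y. p (x + y) \<le> p x + p y"
    and le: "\<And>t x. t > 0 \<Longrightarrow> p (t *\<^sub>R x) \<le> t * p x"
  shows "sublinear p"
proof -
  have "p (t *\<^sub>R x) = t * p x" if "t > 0" for t x
    using le[of t x] le[of "inverse t" "t *\<^sub>R x"] that by (simp add: field_simps)
  with assms show ?thesis by (simp add: sublinear_def)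
qed

lemma sublinear_0:
  assumes "sublinear p"
  shows "p 0 = 0"
  using sublinear_scaleR[OF assms, of 2 0] by simp

lemma sublinear_minus:
  assumes "sublinear p"
  shows "- p (- x) \<le> p x"
  using sublinear_add[OF assms, of x "- x"] sublinear_0[OF assms] by simp

text \<open>Four functionals below have this shape: the infimum of a chain, the infimum along a ray,
  the distance to a cone, and an upper limit.\<close>

lemma sublinear_Inf:
  assumes ne: "\<And>x. S x \<noteq> {}" and bdd: "\<And>x. bdd_below (S x)"
    and add: "\<And>x y a b. a \<in> S x \<Longrightarrow> b \<in> S y \<Longrightarrow> \<exists>c\<in>S (x + y). c \<le> a + b"
    and scale: "\<And>x t a. a \<in> S x \<Longrightarrow> t > 0 \<Longrightarrow> \<exists>c\<in>S (t *\<^sub>R x). c \<le> t * a"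
  shows "sublinear (\<lambda>x. Inf (S x))"
proof (rule sublinearI)
  fix x y
  have "Inf (S (x + y)) \<le> b + a" if "a \<in> S x" "b \<in> S y" for a b
    using add[OF that] cInf_lower[OF _ bdd] by (metis add.commute order_trans)
  then have "Inf (S (x + y)) - a \<le> Inf (S y)" if "a \<in> S x" for a
    using that by (intro cInf_greatest[OF ne]) (simp add: diff_le_eq)
  then have "Inf (S (x + y)) - Inf (S y) \<le> Inf (S x)"
    by (intro cInf_greatest[OF ne]) (simp add: algebra_simps)
  then show "Inf (S (x + y)) \<le> Inf (S x) + Inf (S y)" by simp
next
  fix t :: real and x assume t: "t > 0"
  have "Inf (S (t *\<^sub>R x)) / t \<le> a" if "a \<in> S x" for a
    using scale[OF that t] cInf_lower[OF _ bdd[of "t *\<^sub>R x"]] t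
    by (fastforce simp: field_simps)
  then have "Inf (S (t *\<^sub>R x)) / t \<le> Inf (S x)"
    by (intro cInf_greatest[OF ne])
  then show "Inf (S (t *\<^sub>R x)) \<le> t * Inf (S x)"
    using t by (simp add: field_simps)
qed

text \<open>Zorn's lemma in the reversed pointwise order. A nonempty chain is bounded by its
  pointwise infimum, which is finite because \<open>f x\<close> is at least \<open>- f (- x)\<close>
  and hence at least \<open>- p (- x)\<close>.\<close>

lemma exists_minimal_sublinear:
  fixes p :: "'a::real_vector \<Rightarrow> real"
  assumes p: "sublinear p"
  obtains q where "sublinear q" "q \<le> p" "\<And>r. sublinear r \<Longrightarrow> r \<le> q \<Longrightarrow> r = q"
proof -
  define Q where "Q = {q. sublinear q \<and> q \<le> p}"
  have "\<exists>m\<in>Q. \<forall>a\<in>Q. a \<le> m \<longrightarrow> a = m"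
  proof (rule predicate_Zorn)
    show "partial_order_on Q (relation_of (\<lambda>x y. y \<le> x) Q)"
      by (auto simp: partial_order_on_def preorder_on_def refl_on_def trans_def antisym_def
          relation_of_def)
  next
    fix C assume "C \<in> Chains (relation_of (\<lambda>x y. y \<le> x) Q)"
    then have C: "C \<subseteq> Q" "\<And>f g. f \<in> C \<Longrightarrow> g \<in> C \<Longrightarrow> f \<le> g \<or> g \<le> f"
      by (auto simp: Chains_def relation_of_def)
    show "\<exists>u\<in>Q. \<forall>a\<in>C. u \<le> a"
    proof (cases "C = {}")
      case True
      then show ?thesis using p by (auto simp: Q_def)
    next
      case False
      have sub: "sublinear f" "f \<le> p" if "f \<in> C" for f
        using that C(1) by (auto simp: Q_def)
      have bdd: "bdd_below ((\<lambda>f. f x) ` C)" for x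
      proof (rule bdd_belowI2)
        fix f assume "f \<in> C"
        then show "- p (- x) \<le> f x"
          using sublinear_minus[OF sub(1), of f x] le_funD[OF sub(2), of f "- x"] by simp
      qed
      define u where "u = (\<lambda>x. Inf ((\<lambda>f. f x) ` C))"
      have "sublinear u"
        unfolding u_def
      proof (rule sublinear_Inf)
        fix x y a b
        assume "a \<in> (\<lambda>f. f x) ` C" "b \<in> (\<lambda>f. f y) ` C"
        then obtain f g where fg: "f \<in> C" "g \<in> C" "a = f x" "b = g y" by auto
        show "\<exists>c\<in>(\<lambda>f. f (x + y)) ` C. c \<le> a + b"
        \<comment> \<open>Members of a chain are comparable, and subadditivity of the smaller one
          handles both summands.\<close>
        proof (cases "f \<le> g")
          case True
          then show ?thesis
            using fg sublinear_add[OF sub(1), of f x y] le_funD[of f g y]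
            by (intro bexI[of _ "f (x + y)"]) auto
        next
          case False
          then have "g \<le> f" using C(2) fg by blast
          then show ?thesis
            using fg sublinear_add[OF sub(1), of g x y] le_funD[of g f x]
            by (intro bexI[of _ "g (x + y)"]) auto
        qed
      next
        fix x and t a :: real
        assume "a \<in> (\<lambda>f. f x) ` C" "t > 0"
        then show "\<exists>c\<in>(\<lambda>f. f (t *\<^sub>R x)) ` C. c \<le> t * a"
          using sublinear_scaleR[OF sub(1)] by fastforce
      qed (use False bdd in auto)
      moreover have le: "u \<le> f" if "f \<in> C" for f
        using cInf_lower[OF _ bdd] that by (auto simp: u_def le_fun_def)
      moreover have "u \<le> p"
        using False le sub(2) by (meson all_not_in_conv order_trans)
      ultimately show ?thesis by (auto simp: Q_def)
    qed
  qed
  then show ?thesis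
    using that by (force simp: Q_def)
qed

text \<open>At \<open>- x\<^sub>0\<close> the functional \<open>q\<close> is at most \<open>- p x\<^sub>0\<close>. This forces a linear functional below \<open>q\<close> to
  agree with \<open>p\<close> at \<open>x\<^sub>0\<close>, and it forces a minimal sublinear functional to be additive.\<close>

lemma sublinear_ray:
  fixes p :: "'a::real_vector \<Rightarrow> real" and x\<^sub>0 :: 'a
  assumes p: "sublinear p"
  defines "q \<equiv> (\<lambda>x. Inf ((\<lambda>t. p (x + t *\<^sub>R x\<^sub>0) - t * p x\<^sub>0) ` {0..}))"
  shows "sublinear q" and "t \<ge> 0 \<Longrightarrow> q x \<le> p (x + t *\<^sub>R x\<^sub>0) - t * p x\<^sub>0"
proof -
  have hom: "p (t *\<^sub>R x) = t * p x" if "t \<ge> 0" for t x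
    using sublinear_scaleR[OF p] sublinear_0[OF p] that by (cases "t = 0") auto
  have bdd: "bdd_below ((\<lambda>t. p (x + t *\<^sub>R x\<^sub>0) - t * p x\<^sub>0) ` {0..})" for x
  proof (rule bdd_belowI2)
    \<comment> \<open>The sum of \<open>x + t *\<^sub>R x\<^sub>0\<close> and \<open>- x\<close> is
      \<open>t *\<^sub>R x\<^sub>0\<close>, at which \<open>p\<close> has the value
      \<open>t * p x\<^sub>0\<close>.\<close>
    fix t :: real assume "t \<in> {0..}"
    then show "- p (- x) \<le> p (x + t *\<^sub>R x\<^sub>0) - t * p x\<^sub>0"
      using sublinear_add[OF p, of "x + t *\<^sub>R x\<^sub>0" "- x"] hom[of t x\<^sub>0] by simp
  qed
  show "t \<ge> 0 \<Longrightarrow> q x \<le> p (x + t *\<^sub>R x\<^sub>0) - t * p x\<^sub>0"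
    unfolding q_def by (rule cInf_lower[OF _ bdd]) auto
  show "sublinear q"
    unfolding q_def
  proof (rule sublinear_Inf)
    fix x y a b
    assume "a \<in> (\<lambda>t. p (x + t *\<^sub>R x\<^sub>0) - t * p x\<^sub>0) ` {0..}"
      "b \<in> (\<lambda>t. p (y + t *\<^sub>R x\<^sub>0) - t * p x\<^sub>0) ` {0..}"
    then obtain s t where st: "s \<ge> 0" "t \<ge> 0" "a = p (x + s *\<^sub>R x\<^sub>0) - s * p x\<^sub>0"
      "b = p (y + t *\<^sub>R x\<^sub>0) - t * p x\<^sub>0" by auto
    have "x + y + (s + t) *\<^sub>R x\<^sub>0 = (x + s *\<^sub>R x\<^sub>0) + (y + t *\<^sub>R x\<^sub>0)"
      by (simp add: algebra_simps)
    then have "p (x + y + (s + t) *\<^sub>R x\<^sub>0) - (s + t) * p x\<^sub>0 \<le> a + b"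
      using st sublinear_add[OF p, of "x + s *\<^sub>R x\<^sub>0" "y + t *\<^sub>R x\<^sub>0"]
      by (simp add: algebra_simps)
    then show "\<exists>c\<in>(\<lambda>t. p (x + y + t *\<^sub>R x\<^sub>0) - t * p x\<^sub>0) ` {0..}. c \<le> a + b"
      using st by (intro bexI[OF _ imageI[of "s + t"]]) auto
  next
    fix x and t a :: real
    assume "a \<in> (\<lambda>t. p (x + t *\<^sub>R x\<^sub>0) - t * p x\<^sub>0) ` {0..}" and t: "t > 0"
    then obtain s where s: "s \<ge> 0" "a = p (x + s *\<^sub>R x\<^sub>0) - s * p x\<^sub>0" by auto
    have "p (t *\<^sub>R x + (t * s) *\<^sub>R x\<^sub>0) - (t * s) * p x\<^sub>0 = t * a"
      using hom[of t "x + s *\<^sub>R x\<^sub>0"] t unfolding s(2) by (simp add: algebra_simps)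
    then show "\<exists>c\<in>(\<lambda>r. p (t *\<^sub>R x + r *\<^sub>R x\<^sub>0) - r * p x\<^sub>0) ` {0..}. c \<le> t * a"
      using s t by (intro bexI[OF _ imageI[of "t * s"]]) auto
  qed (use bdd in auto)
qed

lemma Hahn_Banach_sublinear:
  fixes p :: "'a::real_vector \<Rightarrow> real"
  assumes p: "sublinear p"
  obtains F where "linear F" "\<And>x. F x \<le> p x" "F x\<^sub>0 = p x\<^sub>0"
proof -
  obtain p' where p': "sublinear p'"
    and p'_le: "\<And>t x. t \<ge> 0 \<Longrightarrow> p' x \<le> p (x + t *\<^sub>R x\<^sub>0) - t * p x\<^sub>0"
    using sublinear_ray[OF p] by blast
  obtain F where F: "sublinear F" "F \<le> p'"
    and min: "\<And>r. sublinear r \<Longrightarrow> r \<le> F \<Longrightarrow> r = F"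
    using exists_minimal_sublinear[OF p'] by blast
  have add: "F (x + y) = F x + F y" for x y
  proof (rule antisym)
    obtain r where r: "sublinear r" "\<And>t x. t \<ge> 0 \<Longrightarrow> r x \<le> F (x + t *\<^sub>R y) - t * F y"
      using sublinear_ray[OF F(1)] by blast
    \<comment> \<open>The case \<open>t = 0\<close> gives \<open>r \<le> F\<close>, so minimality
      forces equality; the case \<open>t = 1\<close> is then superadditivity of
      \<open>F\<close>.\<close>
    have "r = F"
      using r(2)[of 0] by (intro min r(1)) (simp add: le_fun_def)
    then show "F x + F y \<le> F (x + y)"
      using r(2)[of 1 x] by simp
  qed (rule sublinear_add[OF F(1)])
  have neg: "F (- x) = - F x" for x
    using add[of x "- x"] sublinear_0[OF F(1)] by simp
  have "F (t *\<^sub>R x) = t * F x" for t x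
  proof (cases t "0::real" rule: linorder_cases)
    case less
    then show ?thesis
      using sublinear_scaleR[OF F(1), of "- t" x] neg[of "t *\<^sub>R x"] by simp
  qed (use sublinear_0[OF F(1)] sublinear_scaleR[OF F(1)] in auto)
  then have "linear F"
    by (intro linearI) (auto simp: add)
  moreover have "F x \<le> p x" for x
    using le_funD[OF F(2), of x] p'_le[of 0 x] by simp
  \<comment> \<open>Taking \<open>t = 1\<close> at \<open>- x\<^sub>0\<close> gives
    \<open>F (- x\<^sub>0) \<le> p 0 - p x\<^sub>0 = - p x\<^sub>0\<close>, and oddness of
    \<open>F\<close> turns this into the missing lower bound.\<close>
  moreover have "F x\<^sub>0 = p x\<^sub>0"
    using le_funD[OF F(2), of "- x\<^sub>0"] p'_le[of 1 "- x\<^sub>0"] sublinear_0[OF p] neg[of x\<^sub>0]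
      calculation(2)[of x\<^sub>0] by simp
  ultimately show ?thesis using that by blast
qed

section \<open>Norming and separating continuous functionals\<close>

lemma Hahn_Banach_blinfun:
  fixes p :: "'a::real_normed_vector \<Rightarrow> real"
  assumes "sublinear p" and bound: "\<And>x. p x \<le> K * norm x"
  obtains f :: "'a \<Rightarrow>\<^sub>L real" where "\<And>x. blinfun_apply f x \<le> p x" "blinfun_apply f x\<^sub>0 = p x\<^sub>0"
proof -
  obtain F where F: "linear F" "\<And>x. F x \<le> p x" "F x\<^sub>0 = p x\<^sub>0"
    using Hahn_Banach_sublinear[OF assms(1)] by blast
  \<comment> \<open>Domination at \<open>x\<close> and at \<open>- x\<close> bounds \<open>F\<close>
    on both sides, which yields continuity.\<close>
  have "\<bar>F x\<bar> \<le> norm x * K" for x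
    using F(2)[of x] F(2)[of "- x"] bound[of x] bound[of "- x"] linear_neg[OF F(1), of x]
    by (simp add: mult.commute)
  then have "bounded_linear F"
    by (intro bounded_linear_intro[where K = K]) (auto simp: linear_add[OF F(1)] linear_scale[OF F(1)])
  then show ?thesis
    using that[of "Blinfun F"] F by (simp add: bounded_linear_Blinfun_apply)
qed

lemma norming_functional:
  fixes x :: "'a::real_normed_vector"
  obtains f :: "'a \<Rightarrow>\<^sub>L real" where "\<And>y. \<bar>blinfun_apply f y\<bar> \<le> norm y" "blinfun_apply f x = norm x"
proof -
  have "sublinear (norm :: 'a \<Rightarrow> real)"
    by (intro sublinearI norm_triangle_ineq) simp
  then obtain f :: "'a \<Rightarrow>\<^sub>L real" where f: "\<And>y. blinfun_apply f y \<le> norm y" "blinfun_apply f x = norm x"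
    using Hahn_Banach_blinfun[of norm 1 x] by auto
  have "\<bar>blinfun_apply f y\<bar> \<le> norm y" for y
    using f(1)[of y] f(1)[of "- y"] by (simp add: blinfun.minus_right abs_le_iff)
  with f that show ?thesis by blast
qed

text \<open>The distance to a convex cone is sublinear and vanishes on the cone. A linear functional
  below it that agrees with it at \<open>x\<^sub>0\<close> is nonpositive on \<open>C\<close>, and
  positive at \<open>x\<^sub>0\<close> because \<open>C\<close> is closed. The cones separated below
  are the order cone and a closed subspace.\<close>

lemma separate_closed_cone:
  fixes C :: "'a::real_normed_vector set"
  assumes "closed C" and C0: "0 \<in> C"
    and C_add: "\<And>x y. x \<in> C \<Longrightarrow> y \<in> C \<Longrightarrow> x + y \<in> C"
    and C_scale: "\<And>t x. t > 0 \<Longrightarrow> x \<in> C \<Longrightarrow> t *\<^sub>R x \<in> C"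
    and "x\<^sub>0 \<notin> C"
  obtains f :: "'a \<Rightarrow>\<^sub>L real" where "\<And>x. x \<in> C \<Longrightarrow> blinfun_apply f x \<le> 0" "blinfun_apply f x\<^sub>0 > 0"
proof -
  \<comment> \<open>By convention \<open>infdist\<close> is 0 for the empty set; the element 0 of
    \<open>C\<close> rules this case out.\<close>
  have eq: "infdist x C = Inf (dist x ` C)" for x
    using C0 by (auto simp: infdist_def)
  have "sublinear (\<lambda>x. Inf (dist x ` C))"
  proof (rule sublinear_Inf)
    fix x y a b assume "a \<in> dist x ` C" "b \<in> dist y ` C"
    then obtain u v where "u \<in> C" "v \<in> C" "a = dist x u" "b = dist y v" by auto
    then show "\<exists>c\<in>dist (x + y) ` C. c \<le> a + b"
      by (intro bexI[OF _ imageI[of "u + v"]]) (auto intro: C_add dist_triangle_add)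
  next
    fix x and t a :: real assume "a \<in> dist x ` C" and t: "t > 0"
    then obtain u where "u \<in> C" "a = dist x u" by auto
    with t show "\<exists>c\<in>dist (t *\<^sub>R x) ` C. c \<le> t * a"
      by (intro bexI[OF _ imageI[of "t *\<^sub>R u"]])
        (auto intro: C_scale simp: dist_norm simp flip: scaleR_diff_right)
  qed (use C0 in auto)
  moreover have "Inf (dist x ` C) \<le> 1 * norm x" for x
    using infdist_le[OF C0, of x] by (simp add: eq)
  ultimately obtain f :: "'a \<Rightarrow>\<^sub>L real"
    where f: "\<And>x. blinfun_apply f x \<le> infdist x C" "blinfun_apply f x\<^sub>0 = infdist x\<^sub>0 C"
    unfolding eq by (rule Hahn_Banach_blinfun[where x\<^sub>0 = x\<^sub>0]) blast
  show ?thesis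
  proof
    show "blinfun_apply f x \<le> 0" if "x \<in> C" for x
      using f(1)[of x] that by simp
    have "infdist x\<^sub>0 C \<noteq> 0"
      using in_closed_iff_infdist_zero[of C x\<^sub>0] assms(1,5) C0 by auto
    then show "blinfun_apply f x\<^sub>0 > 0"
      using f(2) infdist_nonneg[of x\<^sub>0 C] by simp
  qed
qed

section \<open>Weak convergence\<close>

lemma weak_limit_unique:
  fixes x y :: "'a::real_normed_vector"
  assumes "X \<rightharpoonup> x" "X \<rightharpoonup> y"
  shows "x = y"
proof -
  obtain f :: "'a \<Rightarrow>\<^sub>L real" where "blinfun_apply f (x - y) = norm (x - y)"
    using norming_functional by blast
  moreover have "blinfun_apply f x = blinfun_apply f y"
    using assms LIMSEQ_unique[of "\<lambda>n. blinfun_apply f (X n)"]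
    by (simp add: weakly_convergent_to_def)
  ultimately show ?thesis by (simp add: blinfun.diff_right)
qed

lemma weakly_convergent_bounded_linear:
  assumes "X \<rightharpoonup> x" and T: "bounded_linear T"
  shows "(\<lambda>n. T (X n)) \<rightharpoonup> T x"
  unfolding weakly_convergent_to_def
proof
  fix f :: "'b \<Rightarrow>\<^sub>L real"
  have "(\<lambda>n. blinfun_apply (f o\<^sub>L Blinfun T) (X n)) \<longlonglongrightarrow> blinfun_apply (f o\<^sub>L Blinfun T) x"
    using assms(1) by (simp only: weakly_convergent_to_def)
  then show "(\<lambda>n. blinfun_apply f (T (X n))) \<longlonglongrightarrow> blinfun_apply f (T x)"
    by (simp add: bounded_linear_Blinfun_apply[OF T])
qed

lemma weakly_convergent_subseq:
  fixes X :: "nat \<Rightarrow> 'a::real_normed_vector"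
  assumes "X \<rightharpoonup> x" "strict_mono r"
  shows "(X \<circ> r) \<rightharpoonup> x"
  unfolding weakly_convergent_to_def
proof
  fix f :: "'a \<Rightarrow>\<^sub>L real"
  have "(\<lambda>n. blinfun_apply f (X n)) \<longlonglongrightarrow> blinfun_apply f x"
    using assms(1) by (simp add: weakly_convergent_to_def)
  from LIMSEQ_subseq_LIMSEQ[OF this assms(2)]
  show "(\<lambda>n. blinfun_apply f ((X \<circ> r) n)) \<longlonglongrightarrow> blinfun_apply f x"
    by (simp add: o_def)
qed

lemma tendsto_imp_weakly_convergent:
  assumes "X \<longlonglongrightarrow> x"
  shows "X \<rightharpoonup> x"
  using assms unfolding weakly_convergent_to_def by (auto intro: blinfun.tendsto)

lemma weakly_convergent_diff:
  assumes "X \<rightharpoonup> x" "Y \<rightharpoonup> y"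
  shows "(\<lambda>n. X n - Y n) \<rightharpoonup> x - y"
  using assms unfolding weakly_convergent_to_def
  by (auto simp: blinfun.diff_right intro: tendsto_diff)

text \<open>A functional separating the limit from the cone would be nonpositive along the sequence
  and positive at the limit. For the order cone this carries the obstacle constraint over to weak
  limits.\<close>

lemma weakly_convergent_in_closed_cone:
  fixes C :: "'a::real_normed_vector set"
  assumes "closed C" "0 \<in> C"
    and "\<And>x y. x \<in> C \<Longrightarrow> y \<in> C \<Longrightarrow> x + y \<in> C"
    and "\<And>t x. t > 0 \<Longrightarrow> x \<in> C \<Longrightarrow> t *\<^sub>R x \<in> C"
    and "X \<rightharpoonup> x" "\<And>n. X n \<in> C"
  shows "x \<in> C"
proof (rule ccontr)
  assume "x \<notin> C"
  then obtain f :: "'a \<Rightarrow>\<^sub>L real"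
    where "\<And>x. x \<in> C \<Longrightarrow> blinfun_apply f x \<le> 0" "blinfun_apply f x > 0"
    using separate_closed_cone[OF assms(1-4)] by blast
  moreover from assms(5) have "(\<lambda>n. blinfun_apply f (X n)) \<longlonglongrightarrow> blinfun_apply f x"
    by (simp add: weakly_convergent_to_def)
  ultimately show False
    using assms(6) LIMSEQ_le_const2[of "\<lambda>n. blinfun_apply f (X n)" "blinfun_apply f x" 0]
    by fastforce
qed

section \<open>Weak sequential compactness in reflexive spaces\<close>

text \<open>The upper limit of \<open>f (X n)\<close> is sublinear in \<open>f\<close>. A linear functional below it lies in the
  bidual, so it is evaluation at a point.\<close>

lemma reflexive_weak_cluster_point:
  fixes X :: "nat \<Rightarrow> 'a::real_normed_vector"
  assumes "reflexive_space TYPE('a)" and "bounded (range X)"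
  obtains x where "\<And>(f :: 'a \<Rightarrow>\<^sub>L real) c.
    \<forall>\<^sub>F n in sequentially. blinfun_apply f (X n) \<le> c \<Longrightarrow> blinfun_apply f x \<le> c"
proof -
  \<comment> \<open>\<open>S f\<close> consists of the eventual upper bounds of
    \<open>f (X n)\<close>, so its infimum is the upper limit.\<close>
  define S where "S = (\<lambda>f::'a \<Rightarrow>\<^sub>L real. {c. \<forall>\<^sub>F n in sequentially. blinfun_apply f (X n) \<le> c})"
  obtain K where K: "\<And>n. norm (X n) \<le> K"
    using assms(2) by (auto simp: bounded_iff)
  have fK: "\<bar>blinfun_apply f (X n)\<bar> \<le> K * norm f" for f :: "'a \<Rightarrow>\<^sub>L real" and n
    using norm_blinfun[of f "X n"] mult_left_mono[OF K[of n], of "norm f"]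
    by (simp add: mult.commute)
  then have mem: "K * norm f \<in> S f" for f
    by (auto simp: S_def abs_le_iff)
  have low: "- K * norm f \<le> c" if c: "c \<in> S f" for c f
  proof -
    obtain n where "blinfun_apply f (X n) \<le> c"
      using c unfolding S_def by (auto dest: eventually_happens'[OF sequentially_bot])
    then show ?thesis using fK[of f n] by (simp add: abs_le_iff)
  qed
  have bdd: "bdd_below (S f)" for f
    using low by (meson bdd_belowI)
  have "sublinear (\<lambda>f. Inf (S f))"
  proof (rule sublinear_Inf)
    fix f g a b assume ab: "a \<in> S f" "b \<in> S g"
    have "a + b \<in> S (f + g)"
      using eventually_conj[of _ sequentially, OF ab[unfolded S_def, THEN CollectD]]
      by (auto simp: S_def blinfun.add_left elim!: eventually_mono)
    then show "\<exists>c\<in>S (f + g). c \<le> a + b" by blast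
  next
    fix f and t a :: real assume "a \<in> S f" "t > 0"
    then have "t * a \<in> S (t *\<^sub>R f)"
      by (auto simp: S_def blinfun.scaleR_left elim!: eventually_mono)
    then show "\<exists>c\<in>S (t *\<^sub>R f). c \<le> t * a" by blast
  qed (use mem bdd in auto)
  then obtain F :: "('a \<Rightarrow>\<^sub>L real) \<Rightarrow>\<^sub>L real" where F: "\<And>f. blinfun_apply F f \<le> Inf (S f)"
    using Hahn_Banach_blinfun[of "\<lambda>f. Inf (S f)" K 0] cInf_lower[OF mem bdd] by blast
  obtain x where "\<And>f. blinfun_apply F f = blinfun_apply f x"
    using assms(1) unfolding reflexive_space_def by blast
  then have "blinfun_apply f x \<le> c" if "\<forall>\<^sub>F n in sequentially. blinfun_apply f (X n) \<le> c"
    for f :: "'a \<Rightarrow>\<^sub>L real" and c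
    using F[of f] cInf_lower[OF _ bdd, of c f] that by (simp add: S_def)
  with that show ?thesis by blast
qed

section \<open>The separable closed span of a sequence\<close>

lemma closure_add_closed:
  fixes S :: "'a::real_normed_vector set"
  assumes "\<And>x y. x \<in> S \<Longrightarrow> y \<in> S \<Longrightarrow> x + y \<in> S" "x \<in> closure S" "y \<in> closure S"
  shows "x + y \<in> closure S"
proof -
  obtain a b where a: "\<And>n. a n \<in> S" "a \<longlonglongrightarrow> x" and b: "\<And>n. b n \<in> S" "b \<longlonglongrightarrow> y"
    using assms(2,3) by (auto simp: closure_sequential)
  have "(\<lambda>n. a n + b n) \<longlonglongrightarrow> x + y"
    by (rule tendsto_add[OF a(2) b(2)])
  moreover have "\<And>n. a n + b n \<in> S"
    using assms(1) a(1) b(1) by blast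
  ultimately show ?thesis
    unfolding closure_sequential by (intro exI[of _ "\<lambda>n. a n + b n"]) blast
qed

lemma separable_closed_subspace:
  fixes X :: "nat \<Rightarrow> 'a::real_normed_vector"
  obtains D where "countable D" "subspace (closure D)" "\<And>n. X n \<in> closure D"
proof
  \<comment> \<open>Rational combinations are coded by lists of pairs: there are countably many of
    them, and concatenation becomes addition.\<close>
  define g where "g = (\<lambda>l. \<Sum>(q, k)\<leftarrow>l. of_rat q *\<^sub>R X k)"
  define D where "D = range g"
  show "countable D" by (simp add: D_def)
  have "g l + g l' = g (l @ l')" for l l' by (simp add: g_def)
  then have D_add: "x + y \<in> D" if "x \<in> D" "y \<in> D" for x y
    using that by (auto simp: D_def)
  have add: "x + y \<in> closure D" if "x \<in> closure D" "y \<in> closure D" for x y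
    using D_add that by (rule closure_add_closed)
  have "g [] = 0" by (simp add: g_def)
  then have zero: "0 \<in> closure D"
    using closure_subset[of D] unfolding D_def by (metis rangeI subsetD)
  \<comment> \<open>Real coefficients are reached by approximating them with rational ones;
    \<open>D\<close> itself only offers the latter.\<close>
  have X_scale: "c *\<^sub>R X k \<in> closure D" for c k
  proof -
    have "c \<in> closure \<rat>" by (simp add: Rats_closure_real)
    then obtain q where q: "\<And>n. q n \<in> \<rat>" "q \<longlonglongrightarrow> c"
      by (auto simp: closure_sequential)
    have "q n *\<^sub>R X k \<in> D" for n
    proof -
      obtain p where "q n = of_rat p" using q(1) by (auto elim: Rats_cases)
      then have "q n *\<^sub>R X k = g [(p, k)]" by (simp add: g_def)
      then show ?thesis by (simp add: D_def)
    qed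
    moreover have "(\<lambda>n. q n *\<^sub>R X k) \<longlonglongrightarrow> c *\<^sub>R X k"
      using q(2) by (intro tendsto_intros)
    ultimately show ?thesis
      unfolding closure_sequential by (intro exI[of _ "\<lambda>n. q n *\<^sub>R X k"]) blast
  qed
  show "X n \<in> closure D" for n
    using X_scale[of 1 n] by simp
  have "c *\<^sub>R g l \<in> closure D" for c l
  proof (induction l)
    case (Cons a l)
    have "c *\<^sub>R g (a # l) = (c * of_rat (fst a)) *\<^sub>R X (snd a) + c *\<^sub>R g l"
      by (simp add: g_def scaleR_right_distrib split_def)
    with add[OF X_scale Cons.IH] show ?case by metis
  qed (use zero in \<open>simp add: g_def\<close>)
  then have D_scale: "(*\<^sub>R) c ` D \<subseteq> closure D" for c
    by (auto simp: D_def)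
  have "c *\<^sub>R x \<in> closure D" if "x \<in> closure D" for c x
  proof -
    have "(*\<^sub>R) c ` closure D \<subseteq> closure D"
      using closure_minimal[OF D_scale closed_closure] by (simp add: closure_scaleR)
    with that show ?thesis by blast
  qed
  then show "subspace (closure D)"
    using zero add by (simp add: subspace_def)
qed

text \<open>Along a suitable subsequence countably many functionals converge that separate the points
  of the closed span, which contains every weak cluster point. Hence all subsequences share one
  weak cluster point.\<close>

theorem reflexive_bounded_imp_weakly_convergent_subseq:
  fixes X :: "nat \<Rightarrow> 'a::real_normed_vector"
  assumes refl: "reflexive_space TYPE('a)" and bdd: "bounded (range X)"
  obtains x r where "strict_mono r" "(X \<circ> r) \<rightharpoonup> x"
proof -
  obtain D where D: "countable D" "subspace (closure D)" "\<And>n. X n \<in> closure D"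
    using separable_closed_subspace by blast
  define M where "M = closure D"
  have M: "closed M" "subspace M" "\<And>n. X n \<in> M"
    using D by (simp_all add: M_def)
  \<comment> \<open>The norming functionals of the points of \<open>D\<close> are the countably many
    along which the subsequence is extracted.\<close>
  have "\<exists>f::'a \<Rightarrow>\<^sub>L real. (\<forall>y. \<bar>blinfun_apply f y\<bar> \<le> norm y) \<and> blinfun_apply f d = norm d" for d
    by (rule norming_functional[of d]) blast
  then obtain \<phi> :: "'a \<Rightarrow> 'a \<Rightarrow>\<^sub>L real"
    where \<phi>_all: "\<forall>d. (\<forall>y. \<bar>blinfun_apply (\<phi> d) y\<bar> \<le> norm y) \<and> blinfun_apply (\<phi> d) d = norm d"
    by (atomize_elim, intro choice allI)
  have \<phi>: "\<bar>blinfun_apply (\<phi> d) y\<bar> \<le> norm y" "blinfun_apply (\<phi> d) d = norm d" for d y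
    using \<phi>_all by simp_all
  \<comment> \<open>If these functionals vanish at \<open>z\<close>, then
    \<open>norm d = \<phi> d (d - z) \<le> norm (d - z)\<close> for \<open>d\<close> in
    \<open>D\<close>. Choosing \<open>d\<close> closer to \<open>z\<close> than
    \<open>norm z / 2\<close> makes \<open>norm z\<close> smaller than itself.\<close>
  have sep: "z = 0" if z: "z \<in> M" "\<And>d. d \<in> D \<Longrightarrow> blinfun_apply (\<phi> d) z = 0" for z
  proof (rule ccontr)
    assume "z \<noteq> 0"
    then obtain d where d: "d \<in> D" "dist d z < norm z / 2"
      using z(1)[unfolded M_def closure_approachable, rule_format, of "norm z / 2"] by auto
    have "norm d \<le> norm (d - z)"
      using \<phi>(1)[of d "d - z"] \<phi>(2)[of d] z(2)[OF d(1)] by (simp add: blinfun.diff_right)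
    then show False
      using d(2) norm_triangle_ineq2[of z d] by (simp add: dist_norm norm_minus_commute)
  qed
  obtain K where K: "\<And>n. norm (X n) \<le> K"
    using bdd by (auto simp: bounded_iff)
  have \<phi>_K: "norm (blinfun_apply (\<phi> d) (X n)) \<le> K" if "d \<in> D" for n d
    using \<phi>(1)[of d "X n"] K[of n] by simp
  \<comment> \<open>A diagonal argument over the countable set \<open>D\<close>, applied to
    uniformly bounded scalar sequences.\<close>
  obtain r where r: "strict_mono r"
    and conv: "\<And>d. d \<in> D \<Longrightarrow> \<exists>l. (\<lambda>n. blinfun_apply (\<phi> d) (X (r n))) \<longlonglongrightarrow> l"
    by (rule function_convergent_subsequence[OF D(1), of "\<lambda>n d. blinfun_apply (\<phi> d) (X n)" K])
      (erule \<phi>_K, rule that)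
  \<comment> \<open>The subsequence \<open>s\<close> is arbitrary, but the values of
    \<open>\<phi> d\<close> at the point found are the limits along \<open>r\<close>. They do not
    depend on \<open>s\<close>, and this will identify all such points.\<close>
  have cluster: "\<exists>x\<in>M. (\<forall>d\<in>D. (\<lambda>n. blinfun_apply (\<phi> d) (X (r n))) \<longlonglongrightarrow> blinfun_apply (\<phi> d) x)
      \<and> (\<forall>(f :: 'a \<Rightarrow>\<^sub>L real) c. (\<forall>n. blinfun_apply f (X (r (s n))) \<le> c) \<longrightarrow> blinfun_apply f x \<le> c)"
    if s: "strict_mono s" for s :: "nat \<Rightarrow> nat"
  proof -
    have "bounded (range (\<lambda>n. X (r (s n))))"
      by (rule bounded_subset[OF bdd]) auto
    then obtain x where x: "\<And>(f :: 'a \<Rightarrow>\<^sub>L real) c.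
        \<forall>\<^sub>F n in sequentially. blinfun_apply f (X (r (s n))) \<le> c \<Longrightarrow>
        blinfun_apply f x \<le> c"
      using reflexive_weak_cluster_point[OF refl] by blast
    have "x \<in> M"
    \<comment> \<open>A functional separating \<open>x\<close> from \<open>M\<close> is nonpositive
      at every term, hence at \<open>x\<close> by the cluster property with bound 0.\<close>
    proof (rule ccontr)
      assume "x \<notin> M"
      then obtain f :: "'a \<Rightarrow>\<^sub>L real"
        where f: "\<And>x. x \<in> M \<Longrightarrow> blinfun_apply f x \<le> 0" "blinfun_apply f x > 0"
        using separate_closed_cone[of M x] M by (auto simp: subspace_def)
      then show False using x[of f 0] M(3) by fastforce
    qed
    moreover have "(\<lambda>n. blinfun_apply (\<phi> d) (X (r n))) \<longlonglongrightarrow> blinfun_apply (\<phi> d) x" if d: "d \<in> D" for d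
    proof -
      obtain l where l: "(\<lambda>n. blinfun_apply (\<phi> d) (X (r n))) \<longlonglongrightarrow> l"
        using conv[OF d] by blast
      then have ls: "(\<lambda>n. blinfun_apply (\<phi> d) (X (r (s n)))) \<longlonglongrightarrow> l"
        using LIMSEQ_subseq_LIMSEQ[OF _ s] by (fastforce simp: o_def)
      \<comment> \<open>The cluster property only transfers upper bounds, so it is used for
        \<open>\<phi> d\<close> and for \<open>- \<phi> d\<close>.\<close>
      have "blinfun_apply (\<phi> d) x \<le> l + e" if "e > 0" for e
        using order_tendstoD(2)[OF ls, of "l + e"] that
        by (intro x) (auto elim: eventually_mono)
      moreover have "blinfun_apply (- \<phi> d) x \<le> - l + e" if "e > 0" for e
        using order_tendstoD(1)[OF ls, of "l - e"] that
        by (intro x) (auto simp: blinfun.minus_left elim: eventually_mono)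
      ultimately have "blinfun_apply (\<phi> d) x \<le> l" "- blinfun_apply (\<phi> d) x \<le> - l"
        by (auto intro: field_le_epsilon simp only: blinfun.minus_left)
      with l show ?thesis by simp
    qed
    moreover have "blinfun_apply f x \<le> c" if "\<And>n. blinfun_apply f (X (r (s n))) \<le> c"
      for f :: "'a \<Rightarrow>\<^sub>L real" and c
      using that by (intro x) simp
    ultimately show ?thesis by (intro bexI[of _ x]) auto
  qed
  obtain x where x: "x \<in> M"
    "\<And>d. d \<in> D \<Longrightarrow> (\<lambda>n. blinfun_apply (\<phi> d) (X (r n))) \<longlonglongrightarrow> blinfun_apply (\<phi> d) x"
    using cluster[OF strict_mono_id] by meson
  \<comment> \<open>Otherwise \<open>f\<close> is at least \<open>c\<close> along a subsequence, and
    so at a cluster point \<open>y\<close> of it. All \<open>\<phi> d\<close> agree at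
    \<open>x\<close> and \<open>y\<close>, so \<open>y = x\<close>, a contradiction. The estimate
    from below is this one for \<open>- f\<close>.\<close>
  have upper: "\<forall>\<^sub>F n in sequentially. blinfun_apply f (X (r n)) < c"
    if c: "blinfun_apply f x < c" for f :: "'a \<Rightarrow>\<^sub>L real" and c
  proof (rule ccontr)
    assume "\<not> ?thesis"
    then have "\<exists>\<^sub>F n in sequentially. blinfun_apply (- f) (X (r n)) \<le> - c"
      by (auto simp: frequently_def blinfun.minus_left not_le)
    then have "infinite {n. blinfun_apply (- f) (X (r n)) \<le> - c}"
      by (simp add: frequently_cofinite flip: cofinite_eq_sequentially)
    from infinite_enumerate[OF this] obtain s :: "nat \<Rightarrow> nat" where s: "strict_mono s"
      "\<And>n. blinfun_apply (- f) (X (r (s n))) \<le> - c" by auto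
    obtain y where y: "y \<in> M"
      "\<And>d. d \<in> D \<Longrightarrow> (\<lambda>n. blinfun_apply (\<phi> d) (X (r n))) \<longlonglongrightarrow> blinfun_apply (\<phi> d) y"
      "blinfun_apply (- f) y \<le> - c"
      using cluster[OF s(1)] s(2) by meson
    have "x - y = 0"
    proof (rule sep)
      show "blinfun_apply (\<phi> d) (x - y) = 0" if "d \<in> D" for d
        using LIMSEQ_unique[OF x(2)[OF that] y(2)[OF that]] by (simp add: blinfun.diff_right)
    qed (use M(2) x(1) y(1) in \<open>auto intro: subspace_diff\<close>)
    with y(3) c show False by (simp add: blinfun.minus_left)
  qed
  have "(X \<circ> r) \<rightharpoonup> x"
    unfolding weakly_convergent_to_def
  proof (intro allI order_tendstoI)
    fix f :: "'a \<Rightarrow>\<^sub>L real" and c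
    assume "c < blinfun_apply f x"
    then show "\<forall>\<^sub>F n in sequentially. c < blinfun_apply f ((X \<circ> r) n)"
      using upper[of "- f" "- c"] by (simp add: blinfun.minus_left)
  qed (use upper in simp)
  with r that show ?thesis by blast
qed

section \<open>Existence of optimal controls\<close>

text \<open>The error \<open>(G n - g) (X n)\<close> is at most \<open>norm (G n - g)\<close> times
  a bound for the sequence; the remaining term \<open>g (X n)\<close> converges by weak
  convergence.\<close>

lemma weak_strong_pairing:
  fixes X :: "nat \<Rightarrow> 'a::real_normed_vector" and G :: "nat \<Rightarrow> 'a \<Rightarrow>\<^sub>L real"
  assumes "G \<longlonglongrightarrow> g" "X \<rightharpoonup> x" "bounded (range X)"
  shows "(\<lambda>n. blinfun_apply (G n) (X n)) \<longlonglongrightarrow> blinfun_apply g x"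
proof -
  obtain K where K: "\<And>n. norm (X n) \<le> K"
    using assms(3) by (auto simp: bounded_iff)
  have "(\<lambda>n. norm (G n - g) * K) \<longlonglongrightarrow> 0 * K"
    using assms(1) by (intro tendsto_mult_right tendsto_norm_zero) (simp add: LIM_zero)
  then have G_lim: "(\<lambda>n. norm (G n - g) * K) \<longlonglongrightarrow> 0" by simp
  have "norm (blinfun_apply (G n - g) (X n)) \<le> norm (G n - g) * K" for n
    using order_trans[OF norm_blinfun mult_left_mono[OF K norm_ge_zero]] .
  then have "(\<lambda>n. blinfun_apply (G n - g) (X n)) \<longlonglongrightarrow> 0"
    by (rule Lim_null_comparison[OF always_eventually[OF allI] G_lim])
  moreover have "(\<lambda>n. blinfun_apply g (X n)) \<longlonglongrightarrow> blinfun_apply g x"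
    using assms(2) by (simp add: weakly_convergent_to_def)
  ultimately have "(\<lambda>n. blinfun_apply (G n - g) (X n) + blinfun_apply g (X n)) \<longlonglongrightarrow> 0 + blinfun_apply g x"
    by (rule tendsto_add)
  then show ?thesis by (simp add: blinfun.diff_left)
qed

text \<open>Compactness provides a strong limit along a subsequence, and weak continuity of
  \<open>j\<close> identifies it as \<open>j x\<close>.\<close>

lemma compact_embedding_weak_to_strong:
  assumes j: "compact_embedding j" and X: "X \<rightharpoonup> x" "bounded (range X)"
  obtains r where "strict_mono r" "(\<lambda>n. j (X (r n))) \<longlonglongrightarrow> j x"
proof -
  have lin: "bounded_linear j" and cpt: "compact (closure (j ` range X))"
    using j X(2) by (auto simp: compact_embedding_def continuous_embedding_def)
  have "j (X n) \<in> closure (j ` range X)" for n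
    using closure_subset[of "j ` range X"] by auto
  then obtain l r where r: "strict_mono r" "((\<lambda>n. j (X n)) \<circ> r) \<longlonglongrightarrow> l"
    using seq_compactE[OF compact_imp_seq_compact[OF cpt], of "\<lambda>n. j (X n)"] by metis
  have "((\<lambda>n. j (X n)) \<circ> r) \<rightharpoonup> j x"
    using weakly_convergent_subseq[OF weakly_convergent_bounded_linear[OF X(1) lin] r(1)] .
  then have "l = j x"
    using weak_limit_unique tendsto_imp_weakly_convergent[OF r(2)] by blast
  with r that show ?thesis by (simp add: o_def)
qed

section \<open>A priori bounds, weak stability of solutions, lower semicontinuity\<close>

lemma abs_bilinear_le:
  fixes A :: "'v::real_normed_vector \<Rightarrow> 'v \<Rightarrow>\<^sub>L real"
  assumes "\<And>u v. blinfun_apply (A u) v \<le> C * norm u * norm v"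
  shows "\<bar>blinfun_apply (A u) v\<bar> \<le> C * norm u * norm v"
  using assms[of u v] assms[of u "- v"] by (simp add: blinfun.minus_right abs_le_iff)

text \<open>Either alternative supplies an admissible test element whose norm is at most
  \<open>a + c * norm y\<close> with \<open>c * C\<^sub>b < C\<^sub>a\<close>. Coercivity then
  absorbs the quadratic part of \<open>A y\<close> at that element.\<close>

lemma QVI_solutions_bounded:
  fixes A :: "'v::{banach, ordered_real_vector, lattice} \<Rightarrow> ('v \<Rightarrow>\<^sub>L real)"
  assumes "C\<^sub>a > 0" and "C\<^sub>b > 0"
    and A_bound: "\<And>u v. blinfun_apply (A u) v \<le> C\<^sub>b * norm u * norm v"
    and coercive: "\<And>u. blinfun_apply (A u) u \<ge> C\<^sub>a * (norm u)\<^sup>2"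
    and "(\<exists>v\<^sub>0. \<forall>v. v\<^sub>0 \<le> \<Phi> v) \<or> (\<exists>C\<^sub>X < C\<^sub>a / C\<^sub>b. \<forall>v. norm (\<Phi> v) \<le> C\<^sub>X * norm v)"
  obtains R where "\<And>g y. norm g \<le> G \<Longrightarrow> y \<in> QVI_solutions A \<Phi> g \<Longrightarrow> norm y \<le> R"
proof -
  obtain a c where ac: "a \<ge> 0" "c \<ge> 0" "c * C\<^sub>b < C\<^sub>a"
    and test: "\<And>y. \<exists>v \<le> \<Phi> y. norm v \<le> a + c * norm y"
    using assms(5)
  proof
    assume "\<exists>v\<^sub>0. \<forall>v. v\<^sub>0 \<le> \<Phi> v"
    then obtain v\<^sub>0 where "\<forall>v. v\<^sub>0 \<le> \<Phi> v" ..
    then show ?thesis using assms(1) by (intro that[of "norm v\<^sub>0" 0]) auto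
  next
    assume "\<exists>C\<^sub>X < C\<^sub>a / C\<^sub>b. \<forall>v. norm (\<Phi> v) \<le> C\<^sub>X * norm v"
    then obtain C where C: "C < C\<^sub>a / C\<^sub>b" "\<And>v. norm (\<Phi> v) \<le> C * norm v" by blast
    \<comment> \<open>\<open>C\<close> may be negative, while the slope \<open>c\<close> has to be
      nonnegative; \<open>max C 0\<close> still lies below
      \<open>C\<^sub>a / C\<^sub>b\<close>.\<close>
    have "norm (\<Phi> v) \<le> max C 0 * norm v" for v
      using C(2)[of v] mult_right_mono[of C "max C 0" "norm v"] by simp
    then show ?thesis
      using assms(1,2) C(1) by (intro that[of 0 "max C 0"]) (auto simp: field_simps max_def)
  qed
  \<comment> \<open>The maximum with 1 leaves the case \<open>norm y > 1\<close>, where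
    \<open>a \<le> a * norm y\<close> and a factor \<open>norm y\<close> can be cancelled.\<close>
  define R where "R = max 1 ((C\<^sub>b * a + \<bar>G\<bar> * (1 + a + c)) / (C\<^sub>a - c * C\<^sub>b))"
  have "norm y \<le> R" if g: "norm g \<le> G" and y: "y \<in> QVI_solutions A \<Phi> g" for g y
  proof (cases "norm y \<le> 1")
    case False
    define Y where "Y = norm y"
    have Y: "Y > 1" using False by (simp add: Y_def)
    obtain v where v: "v \<le> \<Phi> y" "norm v \<le> a + c * Y"
      using test unfolding Y_def by blast
    have "blinfun_apply (A y) y \<le> blinfun_apply (A y) v + blinfun_apply g (y - v)"
      using y v(1) by (auto simp: QVI_solutions_def blinfun.diff_left blinfun.diff_right)
    moreover have "blinfun_apply (A y) v \<le> C\<^sub>b * Y * (a + c * Y)"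
      using order_trans[OF A_bound[of y v, folded Y_def] mult_left_mono[OF v(2)]] assms(2) Y by simp
    moreover have "blinfun_apply g (y - v) \<le> G * (Y + (a + c * Y))"
    proof -
      have "blinfun_apply g (y - v) \<le> norm g * norm (y - v)"
        using norm_blinfun[of g "y - v"] by simp
      also have "\<dots> \<le> G * (Y + (a + c * Y))"
        using g v(2) norm_triangle_ineq4[of y v] order_trans[OF norm_ge_zero g]
        by (intro mult_mono) (auto simp: Y_def)
      finally show ?thesis .
    qed
    moreover have "C\<^sub>a * Y\<^sup>2 \<le> blinfun_apply (A y) y"
      using coercive by (simp add: Y_def)
    moreover have G: "G \<ge> 0" using order_trans[OF norm_ge_zero g] .
    then have "G * (Y + (a + c * Y)) \<le> G * ((1 + a + c) * Y)"
      using Y ac(1) mult_left_mono[of 1 Y a] by (intro mult_left_mono) (auto simp: algebra_simps)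
    ultimately have "Y * ((C\<^sub>a - c * C\<^sub>b) * Y) \<le> Y * (C\<^sub>b * a + \<bar>G\<bar> * (1 + a + c))"
      using G by (simp add: algebra_simps power2_eq_square)
    then have "(C\<^sub>a - c * C\<^sub>b) * Y \<le> C\<^sub>b * a + \<bar>G\<bar> * (1 + a + c)"
      using Y by simp
    then have "Y \<le> (C\<^sub>b * a + \<bar>G\<bar> * (1 + a + c)) / (C\<^sub>a - c * C\<^sub>b)"
      using ac(3) by (simp add: pos_le_divide_eq mult.commute)
    then show ?thesis by (simp add: R_def Y_def)
  qed (simp add: R_def)
  with that show ?thesis by blast
qed

text \<open>A test element \<open>v \<le> \<Phi> z\<close> is turned into test elements \<open>v + (\<Phi> (y n) - \<Phi> z)\<close> for the
  approximating problems. Monotonicity of \<open>A\<close> bounds the quadratic term from below by one that is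
  affine in \<open>y n\<close>.\<close>

lemma QVI_solutions_weak_limit:
  fixes A :: "'v::{banach, ordered_real_vector, lattice} \<Rightarrow> ('v \<Rightarrow>\<^sub>L real)"
  assumes closed: "closed {v::'v. 0 \<le> v}"
    and lin: "linear A"
    and A_bound: "\<And>u v. blinfun_apply (A u) v \<le> C\<^sub>b * norm u * norm v"
    and mono: "\<And>u. 0 \<le> blinfun_apply (A u) u"
    and \<Phi>: "completely_continuous \<Phi>"
    and y: "y \<rightharpoonup> z" "bounded (range y)"
    and g: "g \<longlonglongrightarrow> h"
    and sol: "\<And>n. y n \<in> QVI_solutions A \<Phi> (g n)"
  shows "z \<in> QVI_solutions A \<Phi> h"
proof -
  have \<Phi>_lim: "(\<lambda>n. \<Phi> (y n)) \<longlonglongrightarrow> \<Phi> z"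
    using \<Phi> y(1) by (simp add: completely_continuous_def)
  have "\<Phi> z - z \<in> {v. 0 \<le> v}"
  proof (rule weakly_convergent_in_closed_cone[OF closed])
    show "(\<lambda>n. \<Phi> (y n) - y n) \<rightharpoonup> \<Phi> z - z"
      using weakly_convergent_diff[OF tendsto_imp_weakly_convergent[OF \<Phi>_lim] y(1)] .
    show "\<Phi> (y n) - y n \<in> {v. 0 \<le> v}" for n
      using sol[of n] by (simp add: QVI_solutions_def)
  qed (auto intro: scaleR_nonneg_nonneg)
  moreover have "blinfun_apply (A z - h) (z - v) \<le> 0" if v: "v \<le> \<Phi> z" for v
  proof -
    define w where "w = (\<lambda>n. \<Phi> (y n) - \<Phi> z)"
    have w: "w \<longlonglongrightarrow> 0"
      unfolding w_def using \<Phi>_lim by (simp add: LIM_zero)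
    obtain K where K: "\<And>n. norm (y n) \<le> K"
      using y(2) by (auto simp: bounded_iff)
    \<comment> \<open>For fixed \<open>u\<close> this is a bounded linear functional of the argument
      of \<open>A\<close>; weak convergence of its values in the reals is tested with the
      identity.\<close>
    have Ay: "(\<lambda>n. blinfun_apply (A (y n)) u) \<longlonglongrightarrow> blinfun_apply (A z) u" for u
    proof -
      have "bounded_linear (\<lambda>x. blinfun_apply (A x) u)"
        by (rule bounded_linear_intro[where K = "C\<^sub>b * norm u"])
          (use abs_bilinear_le[of A, OF A_bound] in \<open>auto simp: linear_add[OF lin]
            linear_scale[OF lin] blinfun.add_left blinfun.scaleR_left mult_ac\<close>)
      from weakly_convergent_bounded_linear[OF y(1) this]
      show ?thesis
        unfolding weakly_convergent_to_def by (auto dest: spec[of _ id_blinfun])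
    qed
    have A_diff: "A (a - b) = A a - A b" for a b
      by (rule linear_diff[OF lin])
    have Aw: "(\<lambda>n. blinfun_apply (A (y n)) (w n)) \<longlonglongrightarrow> 0"
    proof (rule tendsto_0_le[where K = "\<bar>C\<^sub>b\<bar> * K"])
      have "\<bar>blinfun_apply (A (y n)) (w n)\<bar> \<le> norm (w n) * (\<bar>C\<^sub>b\<bar> * K)" for n
      proof -
        have "\<bar>blinfun_apply (A (y n)) (w n)\<bar> \<le> C\<^sub>b * norm (y n) * norm (w n)"
          by (rule abs_bilinear_le[of A, OF A_bound])
        also have "\<dots> \<le> \<bar>C\<^sub>b\<bar> * K * norm (w n)"
          using K[of n] by (intro mult_right_mono mult_mono) auto
        finally show ?thesis by (simp add: mult.commute)
      qed
      then show "\<forall>\<^sub>F n in sequentially. norm (blinfun_apply (A (y n)) (w n)) \<le> norm (w n) * (\<bar>C\<^sub>b\<bar> * K)"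
        by simp
    qed (rule w)
    have y': "(\<lambda>n. y n - (v + w n)) \<rightharpoonup> z - (v + 0)"
      using w by (intro weakly_convergent_diff y(1) tendsto_imp_weakly_convergent tendsto_intros)
    have "bounded (range (\<lambda>n. v + w n))"
      using w by (intro convergent_imp_bounded[where l = "v + 0"] tendsto_intros)
    then have "bounded (range (\<lambda>n. y n - (v + w n)))"
      using y(2) by (intro bounded_minus_comp)
    then have gy: "(\<lambda>n. blinfun_apply (g n) (y n - (v + w n))) \<longlonglongrightarrow> blinfun_apply h (z - v)"
      using weak_strong_pairing[OF g y'] by simp
    \<comment> \<open>Expanding \<open>0 \<le> A (y n - z) (y n - z)\<close> bounds
      \<open>A (y n) (y n)\<close> from below by \<open>A z (y n) + A (y n) z - A z z\<close>, which
      converges to \<open>A z z\<close>.\<close>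
    have "blinfun_apply (A z) (y n) + blinfun_apply (A (y n)) z - blinfun_apply (A z) z
        - blinfun_apply (A (y n)) v - blinfun_apply (A (y n)) (w n)
        - blinfun_apply (g n) (y n - (v + w n)) \<le> 0" for n
    proof -
      have "v + w n \<le> \<Phi> (y n)" using v by (simp add: w_def algebra_simps add_mono)
      then have "blinfun_apply (A (y n) - g n) (y n - (v + w n)) \<le> 0"
        using sol[of n] by (simp add: QVI_solutions_def)
      moreover have "0 \<le> blinfun_apply (A (y n - z)) (y n - z)" by (rule mono)
      ultimately show ?thesis
        by (simp add: A_diff blinfun.diff_left blinfun.diff_right blinfun.add_right)
    qed
    moreover have Az: "(\<lambda>n. blinfun_apply (A z) (y n)) \<longlonglongrightarrow> blinfun_apply (A z) z"
      using y(1) by (simp add: weakly_convergent_to_def)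
    have "(\<lambda>n. blinfun_apply (A z) (y n) + blinfun_apply (A (y n)) z - blinfun_apply (A z) z
        - blinfun_apply (A (y n)) v - blinfun_apply (A (y n)) (w n)
        - blinfun_apply (g n) (y n - (v + w n)))
      \<longlonglongrightarrow> blinfun_apply (A z) z + blinfun_apply (A z) z - blinfun_apply (A z) z
        - blinfun_apply (A z) v - 0 - blinfun_apply h (z - v)"
      by (intro tendsto_add tendsto_diff tendsto_const Az Ay Aw gy)
    ultimately have "blinfun_apply (A z) z + blinfun_apply (A z) z - blinfun_apply (A z) z
        - blinfun_apply (A z) v - 0 - blinfun_apply h (z - v) \<le> 0"
      by (intro LIMSEQ_le_const2) auto
    then show ?thesis by (simp add: blinfun.diff_left blinfun.diff_right)
  qed
  ultimately show ?thesis by (simp add: QVI_solutions_def)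
qed

text \<open>The squares of norming functionals at the weak limits bound the cost from below and
  converge, so no subsequence realising a lower limit is needed.\<close>

lemma cost_weakly_lower_semicontinuous:
  fixes i :: "'v::real_normed_vector \<Rightarrow> 'h::real_normed_vector"
    and X :: "nat \<Rightarrow> 'u::real_normed_vector"
  assumes "bounded_linear i" "\<nu> \<ge> 0" "X \<rightharpoonup> u" "Y \<rightharpoonup> y"
    and m: "(\<lambda>n. cost i y\<^sub>d \<nu> (X n) (Y n)) \<longlonglongrightarrow> m"
  shows "cost i y\<^sub>d \<nu> u y \<le> m"
proof -
  obtain f :: "'h \<Rightarrow>\<^sub>L real"
    where f: "\<And>z. \<bar>blinfun_apply f z\<bar> \<le> norm z" "blinfun_apply f (i y - y\<^sub>d) = norm (i y - y\<^sub>d)"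
    using norming_functional by blast
  obtain g :: "'u \<Rightarrow>\<^sub>L real"
    where g: "\<And>z. \<bar>blinfun_apply g z\<bar> \<le> norm z" "blinfun_apply g u = norm u"
    using norming_functional by blast
  have "(\<lambda>n. i (Y n) - y\<^sub>d) \<rightharpoonup> i y - y\<^sub>d"
    using weakly_convergent_diff[OF weakly_convergent_bounded_linear[OF assms(4,1)]
        tendsto_imp_weakly_convergent[OF tendsto_const]] .
  then have f_lim: "(\<lambda>n. blinfun_apply f (i (Y n) - y\<^sub>d)) \<longlonglongrightarrow> blinfun_apply f (i y - y\<^sub>d)"
    by (simp only: weakly_convergent_to_def)
  have g_lim: "(\<lambda>n. blinfun_apply g (X n)) \<longlonglongrightarrow> blinfun_apply g u"
    using assms(3) by (simp only: weakly_convergent_to_def)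
  have lim: "(\<lambda>n. 1 / 2 * (blinfun_apply f (i (Y n) - y\<^sub>d))\<^sup>2 + \<nu> / 2 * (blinfun_apply g (X n))\<^sup>2)
      \<longlonglongrightarrow> 1 / 2 * (blinfun_apply f (i y - y\<^sub>d))\<^sup>2 + \<nu> / 2 * (blinfun_apply g u)\<^sup>2"
    by (intro tendsto_add tendsto_mult tendsto_power tendsto_const f_lim g_lim)
  have "1 / 2 * (blinfun_apply f (i (Y n) - y\<^sub>d))\<^sup>2 + \<nu> / 2 * (blinfun_apply g (X n))\<^sup>2
      \<le> cost i y\<^sub>d \<nu> (X n) (Y n)" for n
    unfolding cost_def using assms(2) f(1) g(1)
    by (intro add_mono mult_left_mono power2_le_iff_abs_le[THEN iffD2]) auto
  then have "1 / 2 * (blinfun_apply f (i y - y\<^sub>d))\<^sup>2 + \<nu> / 2 * (blinfun_apply g u)\<^sup>2 \<le> m"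
    by (intro LIMSEQ_le[OF lim m]) blast
  then show ?thesis by (simp add: cost_def f(2) g(2))
qed

section \<open>Existence of a minimizer\<close>

theorem theorem4p1:
  fixes A :: "'v::{banach, ordered_real_vector, lattice} \<Rightarrow> ('v \<Rightarrow>\<^sub>L real)"
    and \<Phi> :: "'v \<Rightarrow> 'v"
    and i :: "'v \<Rightarrow> 'h::banach"
    and j :: "'u::banach \<Rightarrow> ('v \<Rightarrow>\<^sub>L real)"
    and U\<^sub>a\<^sub>d :: "'u set"
    and y\<^sub>d :: 'h
    and \<nu> C\<^sub>a C\<^sub>b :: real
  assumes "reflexive_space TYPE('v)"
    and "reflexive_space TYPE('h)"
    and "reflexive_space TYPE('u)"
    and "closed {v::'v. 0 \<le> v}"
    and "linear A"
    and "C\<^sub>a > 0" and "C\<^sub>b > 0"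
    and "\<And>u v. blinfun_apply (A u) v \<le> C\<^sub>b * norm u * norm v"
    and "\<And>u. blinfun_apply (A u) u \<ge> C\<^sub>a * (norm u)\<^sup>2"
    and "\<And>u. blinfun_apply (A (pos_part u)) (neg_part u) \<le> 0"
    and "continuous_embedding i"
    and "compact_embedding j"
    and "U\<^sub>a\<^sub>d \<noteq> {}"
    and "weakly_seq_closed U\<^sub>a\<^sub>d"
    and "\<nu> > 0"
    and "\<And>u. u \<in> U\<^sub>a\<^sub>d \<Longrightarrow> QVI_solutions A \<Phi> (j u) \<noteq> {}"
    and "(\<exists>v\<^sub>0. \<forall>v. v\<^sub>0 \<le> \<Phi> v) \<or> (\<exists>C\<^sub>X < C\<^sub>a / C\<^sub>b. \<forall>v. norm (\<Phi> v) \<le> C\<^sub>X * norm v)"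
    and "completely_continuous \<Phi>"
  shows "\<exists>u' \<in> U\<^sub>a\<^sub>d. \<exists>y' \<in> QVI_solutions A \<Phi> (j u').
           \<forall>u \<in> U\<^sub>a\<^sub>d. \<forall>y \<in> QVI_solutions A \<Phi> (j u). cost i y\<^sub>d \<nu> u' y' \<le> cost i y\<^sub>d \<nu> u y"
proof -
  define S where "S = {cost i y\<^sub>d \<nu> u y |u y. u \<in> U\<^sub>a\<^sub>d \<and> y \<in> QVI_solutions A \<Phi> (j u)}"
  have S_ne: "S \<noteq> {}" unfolding S_def using assms(13,16) by blast
  have S_bdd: "bdd_below S"
    using \<open>\<nu> > 0\<close> by (intro bdd_belowI[of _ 0]) (auto simp: S_def cost_def)
  obtain c where c: "\<And>n. c n \<in> S" "c \<longlonglongrightarrow> Inf S"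
    using closure_contains_Inf[OF S_ne S_bdd] by (auto simp: closure_sequential)
  have "\<exists>u y. u \<in> U\<^sub>a\<^sub>d \<and> y \<in> QVI_solutions A \<Phi> (j u) \<and> c n = cost i y\<^sub>d \<nu> u y" for n
    using c(1)[of n] by (auto simp: S_def)
  then obtain u y where uy: "\<And>n. u n \<in> U\<^sub>a\<^sub>d" "\<And>n. y n \<in> QVI_solutions A \<Phi> (j (u n))"
    "\<And>n. c n = cost i y\<^sub>d \<nu> (u n) (y n)"
    by metis
  have bdd_u: "bounded (range u)"
  proof -
    obtain K where K: "\<And>n. \<bar>c n\<bar> \<le> K"
      using convergent_imp_bounded[OF c(2)] by (auto simp: bounded_iff)
    \<comment> \<open>The inequality \<open>2 * s \<le> s^2 + 1\<close> gives a bound without square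
      roots.\<close>
    have "norm (u n) \<le> 2 * K / \<nu> + 1" for n
    proof -
      have "\<nu> / 2 * (norm (u n))\<^sup>2 \<le> cost i y\<^sub>d \<nu> (u n) (y n)" by (simp add: cost_def)
      then have "(norm (u n))\<^sup>2 \<le> 2 * K / \<nu>"
        using abs_le_D1[OF K[of n]] \<open>\<nu> > 0\<close> by (simp add: uy(3) field_simps)
      moreover have "2 * norm (u n) \<le> (norm (u n))\<^sup>2 + 1"
        using zero_le_power2[of "norm (u n) - 1"] by (simp add: power2_diff)
      ultimately show ?thesis using norm_ge_zero[of "u n"] by linarith
    qed
    then show ?thesis by (auto simp: bounded_iff)
  qed
  have bdd_y: "bounded (range y)"
  proof -
    have "bounded_linear j"
      using assms(12) by (simp add: compact_embedding_def continuous_embedding_def)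
    then obtain G where G: "\<And>n. norm (j (u n)) \<le> G"
      using bounded_linear_image[OF bdd_u] by (auto simp: bounded_iff)
    obtain R where "\<And>g y. norm g \<le> G \<Longrightarrow> y \<in> QVI_solutions A \<Phi> g \<Longrightarrow> norm y \<le> R"
      using QVI_solutions_bounded[of C\<^sub>a C\<^sub>b A \<Phi> G] assms(6-9,17) by blast
    then have "norm (y n) \<le> R" for n
      using G uy(2) by blast
    then show ?thesis by (auto simp: bounded_iff)
  qed
  \<comment> \<open>Three successive extractions: weak convergence of the controls, weak convergence
    of the states, strong convergence of the images under \<open>j\<close>.\<close>
  obtain u' r where r: "strict_mono r" "(u \<circ> r) \<rightharpoonup> u'"
    using reflexive_bounded_imp_weakly_convergent_subseq[OF assms(3) bdd_u] .
  have "bounded (range (y \<circ> r))"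
    using bdd_y by (rule bounded_subset) auto
  then obtain y' s where s: "strict_mono s" "(y \<circ> r \<circ> s) \<rightharpoonup> y'"
    by (rule reflexive_bounded_imp_weakly_convergent_subseq[OF assms(1)])
  have us: "(u \<circ> r \<circ> s) \<rightharpoonup> u'"
    by (rule weakly_convergent_subseq[OF r(2) s(1)])
  have "bounded (range (u \<circ> r \<circ> s))"
    using bdd_u by (rule bounded_subset) auto
  then obtain t where t: "strict_mono t" "(\<lambda>n. j ((u \<circ> r \<circ> s) (t n))) \<longlonglongrightarrow> j u'"
    using compact_embedding_weak_to_strong[OF assms(12) us] by blast
  define k where "k = r \<circ> s \<circ> t"
  have k: "strict_mono k" unfolding k_def by (intro strict_mono_o r(1) s(1) t(1))
  have uk: "(u \<circ> k) \<rightharpoonup> u'" and yk: "(y \<circ> k) \<rightharpoonup> y'"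
    using weakly_convergent_subseq[OF us t(1)] weakly_convergent_subseq[OF s(2) t(1)]
    by (simp_all add: k_def o_assoc)
  have "u' \<in> U\<^sub>a\<^sub>d"
    using assms(14) uk uy(1) unfolding weakly_seq_closed_def by (metis comp_apply)
  moreover have "y' \<in> QVI_solutions A \<Phi> (j u')"
  proof (rule QVI_solutions_weak_limit[OF assms(4,5,8) _ assms(18) yk])
    show "0 \<le> blinfun_apply (A v) v" for v
      using assms(9)[of v] assms(6) by (meson less_imp_le mult_nonneg_nonneg order_trans zero_le_power2)
    show "bounded (range (y \<circ> k))"
      using bdd_y by (rule bounded_subset) auto
    show "(\<lambda>n. j (u (k n))) \<longlonglongrightarrow> j u'"
      using t(2) by (simp add: k_def)
    show "(y \<circ> k) n \<in> QVI_solutions A \<Phi> (j (u (k n)))" for n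
      using uy(2) by simp
  qed
  moreover have "cost i y\<^sub>d \<nu> u' y' \<le> cost i y\<^sub>d \<nu> v z"
    if "v \<in> U\<^sub>a\<^sub>d" "z \<in> QVI_solutions A \<Phi> (j v)" for v z
  proof -
    have "(\<lambda>n. cost i y\<^sub>d \<nu> ((u \<circ> k) n) ((y \<circ> k) n)) \<longlonglongrightarrow> Inf S"
      using LIMSEQ_subseq_LIMSEQ[OF c(2) k] by (simp add: o_def uy(3))
    then have "cost i y\<^sub>d \<nu> u' y' \<le> Inf S"
      using assms(11,15)
      by (intro cost_weakly_lower_semicontinuous[OF _ _ uk yk]) (auto simp: continuous_embedding_def)
    also have "\<dots> \<le> cost i y\<^sub>d \<nu> v z"
      using that by (intro cInf_lower[OF _ S_bdd]) (auto simp: S_def)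
    finally show ?thesis .
  qed
  ultimately show ?thesis by blast
qed

end
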